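(* Let $F$ be a vector space, let $G\subset F$ be a proper non-zero subspace, let $T:F\to F$ be a linear operator, and write $\overline{T}=I-T$. Assume: (P1) $\overline{T}(F)\subset G$; (P2) the restriction $\overline{T}_{|G}$ is invertible on $G$, so that $T^{+}=(\overline{T}_{|G})^{-1}:G\to G$ exists. Then the linear operator $\widehat{T}:F\to F$ given by $\widehat{T}=I-T^{+}\overline{T}$ maps $F$ to the subspace $FP(T)=\{f\in F: Tf=f\}$ of fixed points of $T$, and $\widehat{T}$ induces a vector space isomorphism from the factor space $F/G$ to $FP(T)$ (given by $[f]\mapsto \widehat{T}f$). In the case when $F=G\oplus S$ for a subspace $S$, $\widehat{T}$ induces (by restriction) an isomorphism from $S$ to $FP(T)$.
   Context: $I$ denotes the identity operator. No topology or norm on $F$ or $G$ is assumed. *)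

theory Defs
  imports Complex_Main "HOL-Library.Set_Algebras" "HOL-Library.FuncSet"
begin

text \<open>
  A vector space \<open>F\<close> is a type \<open>'b\<close> with a scalar multiplication satisfying the locale
  \<open>vector_space\<close>, over an arbitrary field \<open>'a\<close>.
\<close>

definition co_operator :: "('b \<Rightarrow> 'b) \<Rightarrow> 'b \<Rightarrow> 'b::ab_group_add" where
  "co_operator T f = f - T f"

text \<open>Meaningful on \<open>G\<close> only, when \<open>I - T\<close> restricts to a bijection of \<open>G\<close>.\<close>

definition plus_operator :: "'b set \<Rightarrow> ('b \<Rightarrow> 'b) \<Rightarrow> 'b \<Rightarrow> 'b::ab_group_add" where
  "plus_operator G T = inv_into G (co_operator T)"

definition hat_operator :: "'b set \<Rightarrow> ('b \<Rightarrow> 'b) \<Rightarrow> 'b \<Rightarrow> 'b::ab_group_add" where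
  "hat_operator G T f = f - plus_operator G T (co_operator T f)"

definition fixed_points :: "('b \<Rightarrow> 'b) \<Rightarrow> 'b set" where
  "fixed_points T = {f. T f = f}"

text \<open>
  The factor space \<open>F/G\<close> has the cosets \<open>f +o G\<close> as its elements. Addition of cosets is
  elementwise addition of sets. The summand \<open>G\<close> in the scalar multiplication is needed for
  the scalar \<open>0\<close> only, where the image of a coset would be \<open>{0}\<close> rather than \<open>G\<close>.
\<close>

definition factor_space :: "'b::ab_group_add set \<Rightarrow> 'b set set" where
  "factor_space G = range (\<lambda>f. f +o G)"

definition factor_scale :: "('a \<Rightarrow> 'b \<Rightarrow> 'b) \<Rightarrow> 'b set \<Rightarrow> 'a \<Rightarrow> 'b set \<Rightarrow> 'b::ab_group_add set" where
  "factor_scale scale G c A = scale c ` A + G"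

lemma coset_eq_iff:
  assumes "vector_space scale" "module.subspace scale G"
  shows "f +o G = g +o G \<longleftrightarrow> f - g \<in> G"
proof -
  interpret vector_space scale by fact
  show ?thesis
  proof
    assume "f +o G = g +o G"
    moreover have "f \<in> f +o G"
      using subspace_0[OF assms(2)] by (force simp: elt_set_plus_def)
    ultimately show "f - g \<in> G" by (auto simp: elt_set_plus_def)
  next
    assume d: "f - g \<in> G"
    have 1: "\<exists>b\<in>G. f + x = g + b" if "x \<in> G" for x
      using subspace_add[OF assms(2) d that] by (intro bexI[of _ "f - g + x"]) auto
    have 2: "\<exists>b\<in>G. g + x = f + b" if "x \<in> G" for x
      using subspace_diff[OF assms(2) that d] by (intro bexI[of _ "x - (f - g)"]) auto
    show "f +o G = g +o G" using 1 2 by (auto simp: elt_set_plus_def)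
  qed
qed

lemma coset_add:
  assumes "vector_space scale" "module.subspace scale G"
  shows "(f +o G) + (g +o G) = (f + g) +o G"
proof -
  interpret vector_space scale by fact
  have "G + G = G"
    using subspace_add[OF assms(2)] subspace_0[OF assms(2)]
    by (force simp: set_plus_def)
  then show ?thesis by (simp add: set_plus_rearrange)
qed

lemma coset_scale:
  assumes "vector_space scale" "module.subspace scale G"
  shows "factor_scale scale G c (f +o G) = scale c f +o G"
proof -
  interpret vector_space scale by fact
  have 1: "\<exists>b\<in>G. scale c (f + x) + y = scale c f + b" if "x \<in> G" "y \<in> G" for x y
    using subspace_add[OF assms(2) subspace_scale[OF assms(2) that(1)] that(2), of c]
    by (intro bexI[of _ "scale c x + y"]) (auto simp: scale_right_distrib)
  have 2: "\<exists>a\<in>G. \<exists>b\<in>G. scale c f + x = scale c (f + a) + b" if "x \<in> G" for x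
    using that subspace_0[OF assms(2)] by (intro bexI[of _ 0] bexI[of _ x]) auto
  show ?thesis using 1 2
    by (fastforce simp: factor_scale_def set_plus_def elt_set_plus_def)
qed

text \<open>
  Isomorphism of vector spaces given by carrier, addition and scalar multiplication;
  only the values of \<open>h\<close> on the carrier \<open>V\<close> matter.
\<close>

definition vs_iso ::
  "'v set \<Rightarrow> ('v \<Rightarrow> 'v \<Rightarrow> 'v) \<Rightarrow> ('a \<Rightarrow> 'v \<Rightarrow> 'v) \<Rightarrow>
   'w set \<Rightarrow> ('w \<Rightarrow> 'w \<Rightarrow> 'w) \<Rightarrow> ('a \<Rightarrow> 'w \<Rightarrow> 'w) \<Rightarrow> ('v \<Rightarrow> 'w) \<Rightarrow> bool" where
  "vs_iso V addV scaleV W addW scaleW h \<longleftrightarrow>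
     bij_betw h V W \<and>
     (\<forall>x\<in>V. \<forall>y\<in>V. h (addV x y) = addW (h x) (h y)) \<and>
     (\<forall>c. \<forall>x\<in>V. h (scaleV c x) = scaleW c (h x))"

text \<open>\<open>F = G \<oplus> S\<close> for subspaces \<open>G\<close> and \<open>S\<close>.\<close>

definition direct_sum_decomp :: "'b::ab_group_add set \<Rightarrow> 'b set \<Rightarrow> bool" where
  "direct_sum_decomp G S \<longleftrightarrow> G + S = UNIV \<and> G \<inter> S = {0}"

end

theory Submission
  imports Defs
begin

text \<open>
  The operator \<open>T\<^sup>+ (I - T)\<close> is a projection of \<open>F\<close> onto \<open>G\<close> along \<open>ker (I - T) = FP(T)\<close>:
  it is the identity on \<open>G\<close>, and \<open>I - T\<close> kills \<open>f - T\<^sup>+ (I - T) f\<close>. Its complementary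
  projection \<open>I - T\<^sup>+ (I - T)\<close> therefore has range \<open>FP(T)\<close> and kernel \<open>G\<close>, and the claims are
  the first isomorphism theorem for it.
\<close>

text \<open>First isomorphism theorem. Only the values of \<open>\<phi>\<close> on cosets are
  determined, hence the existential form.\<close>

lemma vs_iso_factor_space:
  assumes lin: "Vector_Spaces.linear scale scale' h"
    and sub: "module.subspace scale G"
    and ker: "\<And>f. h f = 0 \<longleftrightarrow> f \<in> G"
  shows "\<exists>\<phi>. (\<forall>f. \<phi> (f +o G) = h f) \<and>
           vs_iso (factor_space G) (+) (factor_scale scale G) (range h) (+) scale' \<phi>"
proof -
  interpret h: Vector_Spaces.linear scale scale' h by fact
  note vs = h.vs1.vector_space_axioms
  \<comment> \<open>One direction makes \<open>h\<close> well defined on cosets, the other makes the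
    induced map injective.\<close>
  have eq: "f +o G = g +o G \<longleftrightarrow> h f = h g" for f g
    using coset_eq_iff[OF vs sub, of f g] ker[of "f - g"] by (simp add: h.diff)
  \<comment> \<open>The chosen representative is immaterial, since by \<open>eq\<close> the map
    \<open>h\<close> is constant on each coset.\<close>
  define \<phi> where "\<phi> A = h (SOME f. f +o G = A)" for A
  have \<phi>: "\<phi> (f +o G) = h f" for f
    unfolding \<phi>_def by (subst eq[symmetric], rule someI[of _ f]) (rule refl)
  have "bij_betw \<phi> (factor_space G) (range h)"
    by (auto simp: bij_betw_def inj_on_def factor_space_def \<phi> eq image_image)
  then have "vs_iso (factor_space G) (+) (factor_scale scale G) (range h) (+) scale' \<phi>"
    by (auto simp: vs_iso_def factor_space_def coset_add[OF vs sub] coset_scale[OF vs sub]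
        \<phi> h.add h.scale)
  with \<phi> show ?thesis by blast
qed

text \<open>A complement \<open>S\<close> meets each coset of the kernel exactly once:
  \<open>G \<inter> S = {0}\<close> gives injectivity, and \<open>G + S = UNIV\<close> shows that
  \<open>S\<close> already attains every value of \<open>h\<close>.\<close>

lemma vs_iso_complement:
  assumes lin: "Vector_Spaces.linear scale scale' h"
    and ker: "\<And>f. h f = 0 \<longleftrightarrow> f \<in> G"
    and S: "module.subspace scale S" and dec: "direct_sum_decomp G S"
  shows "vs_iso S (+) scale (range h) (+) scale' (restrict h S)"
proof -
  interpret h: Vector_Spaces.linear scale scale' h by fact
  note S_closed = h.vs1.subspace_diff[OF S] h.vs1.subspace_add[OF S] h.vs1.subspace_scale[OF S]
  have "inj_on h S"
  proof (rule inj_onI)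
    fix x y assume "x \<in> S" "y \<in> S" "h x = h y"
    then have "x - y \<in> G \<inter> S"
      using ker[of "x - y"] S_closed(1) by (simp add: h.diff)
    also have "G \<inter> S = {0}" using dec by (simp add: direct_sum_decomp_def)
    finally show "x = y" by simp
  qed
  moreover have "h f \<in> h ` S" for f
  proof -
    have "f \<in> G + S" using dec by (simp add: direct_sum_decomp_def)
    then obtain g s where "g \<in> G" "s \<in> S" "f = g + s" by (rule set_plus_elim)
    then show ?thesis using ker[of g] by (simp add: h.add)
  qed
  ultimately have "bij_betw h S (range h)" by (auto simp: bij_betw_def)
  then have "bij_betw (restrict h S) S (range h)"
    by (simp cong: bij_betw_cong)
  \<comment> \<open>Closure of \<open>S\<close> keeps sums and multiples where
    \<open>restrict h S\<close> agrees with \<open>h\<close>; elsewhere it is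
    \<open>undefined\<close>.\<close>
  then show ?thesis by (simp add: vs_iso_def S_closed h.add h.scale)
qed

locale fixed_point_reduction =
  fixes scale :: "'a::field \<Rightarrow> 'b::ab_group_add \<Rightarrow> 'b"
    and G :: "'b set" and T :: "'b \<Rightarrow> 'b"
  assumes lin: "Vector_Spaces.linear scale scale T"
    and sub: "module.subspace scale G"
    and P1: "range (co_operator T) \<subseteq> G"
    and P2: "bij_betw (co_operator T) G G"
begin

sublocale T: Vector_Spaces.linear scale scale T by (fact lin)

lemma co_in: "co_operator T f \<in> G"
  using P1 by auto

lemma co_add: "co_operator T (f + g) = co_operator T f + co_operator T g"
  by (simp add: co_operator_def T.add)

lemma co_scale: "co_operator T (scale c f) = scale c (co_operator T f)"
  by (simp add: co_operator_def T.scale T.vs1.scale_right_diff_distrib)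

lemma co_diff: "co_operator T (f - g) = co_operator T f - co_operator T g"
  by (simp add: co_operator_def T.diff)

lemma plus_in: "g \<in> G \<Longrightarrow> plus_operator G T g \<in> G"
  using P2 unfolding plus_operator_def bij_betw_def by (metis inv_into_into)

lemma co_plus: "g \<in> G \<Longrightarrow> co_operator T (plus_operator G T g) = g"
  using P2 unfolding plus_operator_def by (rule bij_betw_inv_into_right)

text \<open>Injectivity of \<open>I - T\<close> on \<open>G\<close>. Values of the inverse are
  identified by exhibiting a preimage in \<open>G\<close>.\<close>

lemma plus_eqI: "x \<in> G \<Longrightarrow> co_operator T x = g \<Longrightarrow> plus_operator G T g = x"
  using bij_betw_inv_into_left[OF P2] unfolding plus_operator_def by blast

text \<open>The inverse of a linear bijection of \<open>G\<close> is linear: sums and multiples of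
  preimages are preimages in \<open>G\<close>, and these are unique.\<close>

lemma hat_linear: "Vector_Spaces.linear scale scale (hat_operator G T)"
proof -
  let ?P = "\<lambda>f. plus_operator G T (co_operator T f)"
  have "?P (f + g) = ?P f + ?P g" for f g
    by (rule plus_eqI) (simp_all add: co_add co_plus co_in plus_in T.vs1.subspace_add[OF sub])
  moreover have "?P (scale c f) = scale c (?P f)" for c f
    by (rule plus_eqI) (simp_all add: co_scale co_plus co_in plus_in T.vs1.subspace_scale[OF sub])
  ultimately show ?thesis
    by unfold_locales (simp_all add: hat_operator_def T.vs1.scale_right_diff_distrib)
qed

text \<open>A zero value means \<open>f\<close> equals a value of the inverse, which lies in
  \<open>G\<close>; conversely, on \<open>G\<close> the inverse undoes \<open>I - T\<close>.\<close>

lemma hat_eq_0_iff: "hat_operator G T f = 0 \<longleftrightarrow> f \<in> G"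
proof
  assume "hat_operator G T f = 0"
  then show "f \<in> G" using plus_in[OF co_in, of f] by (simp add: hat_operator_def)
next
  assume "f \<in> G"
  then show "hat_operator G T f = 0" using plus_eqI[of f] by (simp add: hat_operator_def)
qed

lemma fixed_points_iff: "f \<in> fixed_points T \<longleftrightarrow> co_operator T f = 0"
  by (auto simp: fixed_points_def co_operator_def)

lemma range_hat: "range (hat_operator G T) = fixed_points T"
proof (intro equalityI subsetI)
  fix y assume "y \<in> range (hat_operator G T)"
  then show "y \<in> fixed_points T"
    \<comment> \<open>Applying \<open>I - T\<close> to \<open>f - T^+ (I - T) f\<close> leaves
      \<open>(I - T) f - (I - T) f = 0\<close>.\<close>
    by (auto simp: fixed_points_iff hat_operator_def co_diff co_plus co_in)
next
  fix y assume "y \<in> fixed_points T"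
  \<comment> \<open>As \<open>I - T\<close> kills a fixed point \<open>y\<close>, this makes the hat
    operator fix \<open>y\<close>, so \<open>y\<close> is its own preimage.\<close>
  moreover have "plus_operator G T 0 = 0"
    by (rule plus_eqI) (simp_all add: T.vs1.subspace_0[OF sub] co_operator_def T.zero)
  ultimately have "y = hat_operator G T y"
    by (simp add: fixed_points_iff hat_operator_def)
  then show "y \<in> range (hat_operator G T)" by (rule range_eqI)
qed

lemma subspace_fixed_points: "module.subspace scale (fixed_points T)"
  by (simp add: T.vs1.subspace_def fixed_points_def T.zero T.add T.scale)

end

theorem theorem1:
  fixes scale :: "'a::field \<Rightarrow> 'b::ab_group_add \<Rightarrow> 'b"
    and G :: "'b set" and T :: "'b \<Rightarrow> 'b"
  assumes "vector_space scale"
    and "module.subspace scale G" and "G \<noteq> UNIV" and "G \<noteq> {0}"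
    and "Vector_Spaces.linear scale scale T"
    and P1: "range (co_operator T) \<subseteq> G"
    and P2: "bij_betw (co_operator T) G G"
  shows "Vector_Spaces.linear scale scale (hat_operator G T) \<and>
    module.subspace scale (fixed_points T) \<and>
    range (hat_operator G T) \<subseteq> fixed_points T \<and>
    (\<exists>\<phi>. (\<forall>f. \<phi> (f +o G) = hat_operator G T f) \<and>
         vs_iso (factor_space G) (+) (factor_scale scale G)
                (fixed_points T) (+) scale \<phi>) \<and>
    (\<forall>S. module.subspace scale S \<and> direct_sum_decomp G S \<longrightarrow>
         vs_iso S (+) scale (fixed_points T) (+) scale (restrict (hat_operator G T) S))"
proof -
  interpret fixed_point_reduction scale G T
    using assms by (simp add: fixed_point_reduction_def)
  show ?thesis
    \<comment> \<open>Both isomorphisms are onto the range of the hat operator, which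
      \<open>range_hat\<close> turns into \<open>fixed_points T\<close>.\<close>
    using hat_linear subspace_fixed_points range_hat
      vs_iso_factor_space[OF hat_linear sub hat_eq_0_iff]
      vs_iso_complement[OF hat_linear hat_eq_0_iff]
    by simp
qed

end
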